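(* Let $s\ge 2$ be an integer. Let $G$ be a graph on a vertex set $V$ with a fixed partition $V=V_1\cup\cdots\cup V_s$, where $|V_i|=n$ for all $i\in[s]$. If $G$ is balanced $K_{2s}$-free, then $$\lVert G\rVert_2 \le \bigl(s^2(s-1)+(s-1)^2\bigr)n^3+4s^3n^2.$$
   Context: Graphs are finite and simple, and edges of $G$ may lie inside the parts $V_i$ as well as between them. $\lVert G\rVert_2=\sum_{v\in V(G)} d_G(v)^2$ is the sum of squared degrees. With respect to the fixed partition $V=V_1\cup\cdots\cup V_s$, a balanced $K_{2s}$ in $G$ is a complete subgraph $K\cong K_{2s}$ of $G$ with $|V(K)\cap V_i|=2$ for every $i\in[s]$. $G$ is balanced $K_{2s}$-free if it contains no balanced $K_{2s}$. *)

theory Defs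
  imports Complex_Main "HOL-Library.Disjoint_Sets" "Graph_Theory.Kuratowski"
begin

text \<open>
  Finite simple graphs are the locale \<open>graph\<close> of the AFP entry Graph-Theory: finite, loop-free
  digraphs without parallel arcs whose arc relation is symmetric. An undirected edge is thus a pair
  of opposite arcs, and the degree of a vertex is its \<open>out_degree\<close> (which equals its \<open>in_degree\<close>).
\<close>

definition degree_square_sum :: "('a, 'b) pre_digraph \<Rightarrow> nat" where
  "degree_square_sum G = (\<Sum>v\<in>verts G. (out_degree G v)\<^sup>2)"

definition balanced_partition :: "nat \<Rightarrow> nat \<Rightarrow> (nat \<Rightarrow> 'a set) \<Rightarrow> 'a set \<Rightarrow> bool" where
  "balanced_partition s n V A \<longleftrightarrow>
     (\<Union>i\<in>{1..s}. V i) = A \<and> disjoint_family_on V {1..s} \<and> (\<forall>i\<in>{1..s}. card (V i) = n)"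

text \<open>\<open>complete_digraph (2 * s) H\<close> says that \<open>H\<close> is a complete graph on exactly \<open>2 * s\<close> vertices.\<close>

definition balanced_complete_in ::
    "nat \<Rightarrow> (nat \<Rightarrow> 'a set) \<Rightarrow> ('a, 'b) pre_digraph \<Rightarrow> ('a, 'b) pre_digraph \<Rightarrow> bool" where
  "balanced_complete_in s V G H \<longleftrightarrow>
     subgraph H G \<and> complete_digraph (2 * s) H \<and> (\<forall>i\<in>{1..s}. card (verts H \<inter> V i) = 2)"

definition balanced_complete_free ::
    "nat \<Rightarrow> (nat \<Rightarrow> 'a set) \<Rightarrow> ('a, 'b) pre_digraph \<Rightarrow> bool" where
  "balanced_complete_free s V G \<longleftrightarrow> \<not> (\<exists>H. balanced_complete_in s V G H)"

end

theory Submission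
  imports Defs
begin

text \<open>
  Replacing a vertex by a non-adjacent copy of another vertex of the same part creates no balanced
  clique. In a balanced-free graph maximising \<open>\<Sum> d(v)\<^sup>2\<close> the weights
  \<open>d(u)\<^sup>2 + 2 \<Sum>\<^bsub>w~u\<^esub> d(w)\<close> therefore agree within each part up to \<open>4sn\<close>. If some vertex has degree
  at most \<open>(s - 1)n\<close>, then its whole part has small weight, and double counting the edges between
  this part and the rest gives the bound. Otherwise every vertex misses fewer than \<open>n\<close> vertices
  (itself included), so \<open>\<Sum> d(v)\<^sup>2 \<le> s\<^sup>3n\<^sup>3 - (2s - 1)nM\<close>, where \<open>M\<close> is the total number of missing ordered
  pairs, and it remains to see that \<open>M \<ge> n\<^sup>2 - sn\<close>. This may be checked in a balanced-free graph with the
  most edges, where degrees agree within each part up to 1: a largest clique with at most two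
  vertices in each part, together with one more vertex, then accounts for \<open>2n\<close> missing pairs.
\<close>

section \<open>Edge relations, degrees and vertex cloning\<close>

definition clique_on :: "('a \<times> 'a) set \<Rightarrow> 'a set \<Rightarrow> bool" where
  "clique_on E K \<longleftrightarrow> (\<forall>x\<in>K. \<forall>y\<in>K. x \<noteq> y \<longrightarrow> (x, y) \<in> E)"

definition deg_in :: "('a \<times> 'a) set \<Rightarrow> 'a set \<Rightarrow> 'a \<Rightarrow> real" where
  "deg_in E S v = (\<Sum>w\<in>S. of_bool ((v, w) \<in> E))"

text \<open>The vertex \<open>v\<close> forgets its own edges and becomes a twin of
  \<open>u\<close>. For irreflexive \<open>E\<close> and \<open>u \<noteq> v\<close> the twins are
  non-adjacent, as membership of \<open>(u, v)\<close> reduces to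
  \<open>(u, u) \<in> E\<close>.\<close>

definition clone :: "('a \<times> 'a) set \<Rightarrow> 'a \<Rightarrow> 'a \<Rightarrow> ('a \<times> 'a) set" where
  "clone E u v = {(x, y). x \<noteq> v \<and> y \<noteq> v \<and> (x, y) \<in> E
     \<or> x = v \<and> y \<noteq> v \<and> (u, y) \<in> E \<or> x \<noteq> v \<and> y = v \<and> (x, u) \<in> E}"

lemma deg_in_eq_card: "finite S \<Longrightarrow> deg_in E S v = real (card (S \<inter> E `` {v}))"
  by (simp add: deg_in_def Int_def)

lemma deg_in_nonneg: "0 \<le> deg_in E S v"
  by (simp add: deg_in_def sum_nonneg)

lemma deg_in_le_card: "deg_in E S v \<le> card S"
  unfolding deg_in_def by (rule sum_bounded_above[where K = 1, simplified]) simp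

lemma deg_in_swap: "sym E \<Longrightarrow> (\<Sum>v\<in>S. of_bool ((v, w) \<in> E)) = deg_in E S w"
  unfolding deg_in_def by (intro sum.cong) (auto dest: symD)

lemma sum_weighted_deg_in_swap:
  assumes "sym E"
  shows "(\<Sum>v\<in>S. \<Sum>w\<in>T. of_bool ((v, w) \<in> E) * f w) = (\<Sum>w\<in>T. f w * deg_in E S w)"
  by (subst sum.swap) (simp add: sum_distrib_right[symmetric] deg_in_swap[OF assms] mult.commute[of _ "deg_in E S _"]
    del: sum_of_bool_eq sum_of_bool_mult_eq sum_mult_of_bool_eq)

lemma sum_deg_in_swap:
  assumes "sym E"
  shows "(\<Sum>v\<in>S. deg_in E T v) = (\<Sum>w\<in>T. deg_in E S w)"
  using sum_weighted_deg_in_swap[OF assms, where f = "\<lambda>_. 1"] by (simp add: deg_in_def)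

text \<open>The correction arises because \<open>v\<close> inherits the neighbours of
  \<open>u\<close> but never becomes its own neighbour.\<close>

lemma deg_in_clone_target:
  assumes "finite A" "v \<in> A"
  shows "deg_in (clone E u v) A v = deg_in E A u - of_bool ((u, v) \<in> E)"
proof -
  have "deg_in (clone E u v) A v = (\<Sum>w\<in>A - {v}. of_bool ((v, w) \<in> clone E u v))"
    unfolding deg_in_def using assms by (subst sum.remove[of A v]) (auto simp: clone_def)
  also have "\<dots> = (\<Sum>w\<in>A - {v}. of_bool ((u, w) \<in> E))"
    by (intro sum.cong) (auto simp: clone_def)
  also have "\<dots> = deg_in E A u - of_bool ((u, v) \<in> E)"
    unfolding deg_in_def using assms by (simp add: sum.remove[of A v] del: sum_of_bool_eq)
  finally show ?thesis .
qed

lemma deg_in_clone_other: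
  assumes "finite A" "v \<in> A" "w \<noteq> v"
  shows "deg_in (clone E u v) A w = deg_in E A w - of_bool ((w, v) \<in> E) + of_bool ((w, u) \<in> E)"
proof -
  have "deg_in (clone E u v) A w
      = of_bool ((w, u) \<in> E) + (\<Sum>x\<in>A - {v}. of_bool ((w, x) \<in> clone E u v))"
    unfolding deg_in_def using assms by (subst sum.remove[of A v]) (auto simp: clone_def)
  also have "(\<Sum>x\<in>A - {v}. of_bool ((w, x) \<in> clone E u v)) = (\<Sum>x\<in>A - {v}. of_bool ((w, x) \<in> E) :: real)"
    using assms by (intro sum.cong) (auto simp: clone_def)
  also have "\<dots> = deg_in E A w - of_bool ((w, v) \<in> E)"
    unfolding deg_in_def using assms by (simp add: sum.remove[of A v] del: sum_of_bool_eq)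
  finally show ?thesis by simp
qed

text \<open>Both sides count the pairs of \<open>S \<times> T\<close> outside \<open>E\<close>. The
  two sets may overlap; for irreflexive \<open>E\<close> a common vertex is then its own
  non-neighbour.\<close>

lemma sum_card_non_adjacent_swap:
  assumes "sym E" "finite S" "finite T"
  shows "(\<Sum>w\<in>S. card (T - E `` {w})) = (\<Sum>v\<in>T. card (S - E `` {v}))"
proof -
  have card_eq: "card (X - E `` {w}) = (\<Sum>x\<in>X. of_bool ((w, x) \<notin> E))" if "finite X" for X w
    using that by (simp add: Diff_eq Int_def)
  have "(\<Sum>w\<in>S. card (T - E `` {w})) = (\<Sum>w\<in>S. \<Sum>v\<in>T. of_bool ((w, v) \<notin> E))"
    using assms by (simp only: card_eq)
  also have "\<dots> = (\<Sum>v\<in>T. \<Sum>w\<in>S. of_bool ((w, v) \<notin> E))"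
    by (rule sum.swap)
  also have "\<dots> = (\<Sum>v\<in>T. \<Sum>w\<in>S. of_bool ((v, w) \<notin> E))"
    using symD[OF assms(1)] by (intro sum.cong refl) (auto simp del: sum_of_bool_eq)
  also have "\<dots> = (\<Sum>v\<in>T. card (S - E `` {v}))"
    using assms by (simp only: card_eq)
  finally show ?thesis .
qed

lemma ex_maximal_value:
  fixes F :: "'b \<Rightarrow> real"
  assumes "finite S" "S \<noteq> {}"
  obtains x where "x \<in> S" "\<And>y. y \<in> S \<Longrightarrow> F y \<le> F x"
proof -
  have "Max (F ` S) \<in> F ` S" using assms by simp
  then obtain x where "x \<in> S" "F x = Max (F ` S)" by auto
  then show thesis using that assms by simp
qed

section \<open>Equipartitions and cloning in balanced-free graphs\<close>

text \<open>Finiteness of \<open>A\<close> is a separate assumption: \<open>card\<close> is 0 on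
  infinite sets, so \<open>n = 0\<close> alone would admit infinite parts.\<close>

locale equipartition =
  fixes s n :: nat and V :: "nat \<Rightarrow> 'a set" and A :: "'a set"
  assumes finite_A: "finite A"
    and union_parts: "(\<Union>i\<in>{1..s}. V i) = A"
    and disjoint_parts: "disjoint_family_on V {1..s}"
    and card_part: "i \<in> {1..s} \<Longrightarrow> card (V i) = n"
begin

text \<open>Graphs on the fixed vertex set are bare relations, so that cloning and the choice of an
  extremal graph involve no arcs.\<close>

definition balanced_free :: "('a \<times> 'a) set \<Rightarrow> bool" where
  "balanced_free E \<longleftrightarrow> E \<subseteq> A \<times> A \<and> sym E \<and> irrefl E \<and>
     \<not> (\<exists>K\<subseteq>A. clique_on E K \<and> (\<forall>i\<in>{1..s}. card (K \<inter> V i) = 2))"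

abbreviation deg :: "('a \<times> 'a) set \<Rightarrow> 'a \<Rightarrow> real" where
  "deg E \<equiv> deg_in E A"

text \<open>The co-degree counts the vertex itself.\<close>

definition codeg :: "('a \<times> 'a) set \<Rightarrow> 'a \<Rightarrow> real" where
  "codeg E v = real (s * n) - deg E v"

lemma part_subset: "i \<in> {1..s} \<Longrightarrow> V i \<subseteq> A"
  using union_parts by auto

lemma finite_part: "i \<in> {1..s} \<Longrightarrow> finite (V i)"
  using part_subset finite_A finite_subset by blast

lemma parts_disjoint: "i \<in> {1..s} \<Longrightarrow> j \<in> {1..s} \<Longrightarrow> i \<noteq> j \<Longrightarrow> V i \<inter> V j = {}"
  using disjoint_parts by (auto simp: disjoint_family_on_def)

lemma sum_parts: "(\<Sum>i\<in>{1..s}. \<Sum>v\<in>T \<inter> V i. f v) = (\<Sum>v\<in>T. f v)" if "T \<subseteq> A"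
proof -
  have "(\<Sum>v\<in>(\<Union>i\<in>{1..s}. T \<inter> V i). f v) = (\<Sum>i\<in>{1..s}. \<Sum>v\<in>T \<inter> V i. f v)"
    using finite_part parts_disjoint by (intro sum.UNION_disjoint) (auto; blast)+
  moreover have "(\<Union>i\<in>{1..s}. T \<inter> V i) = T" using that union_parts by auto
  ultimately show ?thesis by simp
qed

lemma card_A: "card A = s * n"
proof -
  have "card A = (\<Sum>i\<in>{1..s}. card (V i))"
    unfolding union_parts[symmetric] using finite_part parts_disjoint
    by (intro card_UN_disjoint) auto
  then show ?thesis using card_part by simp
qed

lemma deg_le: "deg E v \<le> real (s * n)"
  using deg_in_le_card[of E A v] by (simp add: card_A)

lemma codeg_eq_card: "codeg E v = real (card (A - E `` {v}))"
proof -
  have "card A = card (A \<inter> E `` {v}) + card (A - E `` {v})"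
    using finite_A by (subst card_Un_disjoint[symmetric]) (auto intro: arg_cong[where f = card])
  then show ?thesis using finite_A by (simp add: codeg_def deg_in_eq_card card_A)
qed

text \<open>The twins are non-adjacent, so a balanced clique through \<open>v\<close> avoids
  \<open>u\<close>. Exchanging \<open>v\<close> for \<open>u\<close>, a vertex of the same part,
  turns it into a balanced clique of \<open>E\<close>.\<close>

lemma balanced_free_clone:
  assumes free: "balanced_free E" and i: "i \<in> {1..s}" and u: "u \<in> V i" and v: "v \<in> V i" and "u \<noteq> v"
  shows "balanced_free (clone E u v)"
  unfolding balanced_free_def
proof (intro conjI notI)
  have E: "E \<subseteq> A \<times> A" "sym E" "irrefl E" using free by (auto simp: balanced_free_def)
  have uv: "u \<in> A" "v \<in> A" using i u v part_subset by auto
  show "clone E u v \<subseteq> A \<times> A" using E(1) uv by (auto simp: clone_def)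
  show "sym (clone E u v)" using E(2) by (auto simp: clone_def sym_def)
  show "irrefl (clone E u v)" using E(3) by (auto simp: clone_def irrefl_def)
  assume "\<exists>K\<subseteq>A. clique_on (clone E u v) K \<and> (\<forall>i\<in>{1..s}. card (K \<inter> V i) = 2)"
  then obtain K where K: "K \<subseteq> A" "clique_on (clone E u v) K" "\<forall>i\<in>{1..s}. card (K \<inter> V i) = 2"
    by auto
  show False
  proof (cases "v \<in> K")
    case False
    then have "clique_on E K" using K(2) by (auto simp: clique_on_def clone_def)
    then show False using free K by (auto simp: balanced_free_def)
  next
    case True
    have "(u, v) \<notin> clone E u v" using E(3) \<open>u \<noteq> v\<close> by (auto simp: clone_def irrefl_def)
    then have "u \<notin> K" using K(2) True \<open>u \<noteq> v\<close> by (auto simp: clique_on_def)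
    let ?K = "insert u (K - {v})"
    have "(x, y) \<in> E" if xy: "x \<in> ?K" "y \<in> ?K" "x \<noteq> y" for x y
    proof -
      consider "x = u" "y \<in> K - {v}" | "y = u" "x \<in> K - {v}" | "x \<in> K - {v}" "y \<in> K - {v}"
        using xy by blast
      then show ?thesis
        using K(2) True xy(3) symD[OF E(2)] unfolding clique_on_def clone_def
        by cases (auto | blast)+
    qed
    then have "clique_on E ?K" by (simp add: clique_on_def)
    moreover have "card (?K \<inter> V j) = 2" if j: "j \<in> {1..s}" for j
    proof (cases "j = i")
      case True
      have "?K \<inter> V i = insert u (K \<inter> V i - {v})" using u by auto
      moreover have "card (K \<inter> V i - {v}) = 1"
        using K(3) i v \<open>v \<in> K\<close> by (simp add: card_Diff_singleton)
      moreover have "finite (K \<inter> V i - {v})" using finite_part[OF i] by simp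
      ultimately show ?thesis using True \<open>u \<notin> K\<close> by simp
    next
      case False
      then have "?K \<inter> V j = K \<inter> V j" using parts_disjoint[OF i j] u v by auto
      then show ?thesis using K(3) j by simp
    qed
    moreover have "?K \<subseteq> A" using K(1) uv by auto
    ultimately show False using free by (auto simp: balanced_free_def)
  qed
qed

text \<open>Only finitely many relations fit inside \<open>A \<times> A\<close>. The objective
  \<open>F\<close> is left open because both the sum of squared degrees and the number of edges get
  maximised.\<close>

lemma ex_maximal_balanced_free:
  fixes F :: "('a \<times> 'a) set \<Rightarrow> real"
  assumes "balanced_free E"
  obtains E' where "balanced_free E'" "\<And>H. balanced_free H \<Longrightarrow> F H \<le> F E'"
proof -
  have "finite {E. balanced_free E}"
    by (rule finite_subset[of _ "Pow (A \<times> A)"]) (auto simp: balanced_free_def finite_A)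
  then show thesis using ex_maximal_value[of "{E. balanced_free E}" F] assms that by auto
qed

text \<open>Cloning \<open>u\<close> onto \<open>v\<close> changes the degree sum by
  \<open>2 * (deg E u - deg E v)\<close>, less 2 if the two are adjacent. Maximality forbids a gain,
  which leaves a slack of 1.\<close>

lemma deg_le_of_max_sum:
  assumes free: "balanced_free E"
    and max: "\<And>H. balanced_free H \<Longrightarrow> (\<Sum>w\<in>A. deg H w) \<le> (\<Sum>w\<in>A. deg E w)"
    and i: "i \<in> {1..s}" and u: "u \<in> V i" and v: "v \<in> V i"
  shows "deg E u \<le> deg E v + 1"
proof (cases "u = v")
  case False
  let ?a = "\<lambda>x y. of_bool ((x, y) \<in> E) :: real"
  have E: "sym E" "(v, v) \<notin> E" using free by (auto simp: balanced_free_def irrefl_def)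
  have vA: "v \<in> A" using i v part_subset by auto
  have "(\<Sum>w\<in>A. deg (clone E u v) w) = deg (clone E u v) v + (\<Sum>w\<in>A - {v}. deg (clone E u v) w)"
    using finite_A vA by (rule sum.remove)
  also have "\<dots> = (deg E u - ?a u v) + (\<Sum>w\<in>A - {v}. deg E w - ?a w v + ?a w u)"
    using finite_A vA by (simp add: deg_in_clone_target deg_in_clone_other)
  also have "(\<Sum>w\<in>A - {v}. deg E w - ?a w v + ?a w u)
      = (\<Sum>w\<in>A. deg E w - ?a w v + ?a w u) - (deg E v - ?a v v + ?a v u)"
    using finite_A vA by (simp add: sum.remove)
  also have "(\<Sum>w\<in>A. deg E w - ?a w v + ?a w u) = (\<Sum>w\<in>A. deg E w) - deg E v + deg E u"
    using E(1) by (simp add: sum.distrib sum_subtractf deg_in_swap)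
  finally have "2 * deg E u - 2 * deg E v \<le> ?a u v + ?a v u"
    using max[OF balanced_free_clone[OF free i u v False]] E by simp
  moreover have "?a u v + ?a v u \<le> 2" by simp
  ultimately show ?thesis by linarith
qed simp

text \<open>
  Deleting \<open>u\<close> lowers \<open>\<Sum> d(v)\<^sup>2\<close> by this weight, and duplicating \<open>u\<close> raises it by this weight,
  up to terms of order \<open>sn\<close>.
\<close>

definition cherry_weight :: "('a \<times> 'a) set \<Rightarrow> 'a \<Rightarrow> real" where
  "cherry_weight E u = (deg E u)\<^sup>2 + 2 * (\<Sum>w\<in>A. of_bool ((u, w) \<in> E) * deg E w)"

text \<open>Cloning \<open>u\<close> onto \<open>v\<close> gains the weight of \<open>u\<close> and
  loses that of \<open>v\<close>. The error stems from a possible edge between them and is at most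
  twice the sum of their degrees.\<close>

lemma cherry_weight_le_of_max_sum_squares:
  assumes free: "balanced_free E"
    and max: "\<And>H. balanced_free H \<Longrightarrow> (\<Sum>w\<in>A. (deg H w)\<^sup>2) \<le> (\<Sum>w\<in>A. (deg E w)\<^sup>2)"
    and i: "i \<in> {1..s}" and u: "u \<in> V i" and v: "v \<in> V i"
  shows "cherry_weight E u \<le> cherry_weight E v + 4 * real (s * n)"
proof (cases "u = v")
  case False
  let ?a = "\<lambda>x y. of_bool ((x, y) \<in> E) :: real"
  let ?d = "deg E"
  have E: "sym E" "(v, v) \<notin> E" using free by (auto simp: balanced_free_def irrefl_def)
  have sw: "?a w x = ?a x w" for w x using E(1) by (auto dest: symD)
  have vA: "v \<in> A" using i v part_subset by auto
  \<comment> \<open>A lower bound for the sum of squares of the clone: away from \<open>v\<close>,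
    the squared change \<open>(?a u w - ?a v w)\<^sup>2\<close> is dropped.\<close>
  have "(?d u - ?a u v)\<^sup>2 + (\<Sum>w\<in>A - {v}. (?d w)\<^sup>2 + 2 * (?a u w * ?d w) - 2 * (?a v w * ?d w))
      \<le> (?d u - ?a u v)\<^sup>2 + (\<Sum>w\<in>A - {v}. (?d w - ?a w v + ?a w u)\<^sup>2)"
  proof (intro add_left_mono sum_mono)
    fix w
    have "(?d w - ?a w v + ?a w u)\<^sup>2
        = (?d w)\<^sup>2 + 2 * (?a u w * ?d w) - 2 * (?a v w * ?d w) + (?a u w - ?a v w)\<^sup>2"
      unfolding sw[of w] by (simp add: power2_eq_square algebra_simps)
    then show "(?d w)\<^sup>2 + 2 * (?a u w * ?d w) - 2 * (?a v w * ?d w) \<le> (?d w - ?a w v + ?a w u)\<^sup>2"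
      by simp
  qed
  also have "\<dots> = (\<Sum>w\<in>A. (deg (clone E u v) w)\<^sup>2)"
    using finite_A vA by (simp add: sum.remove[of A v] deg_in_clone_target deg_in_clone_other)
  also have "\<dots> \<le> (\<Sum>w\<in>A. (?d w)\<^sup>2)"
    by (rule max[OF balanced_free_clone[OF free i u v False]])
  also have "(\<Sum>w\<in>A - {v}. (?d w)\<^sup>2 + 2 * (?a u w * ?d w) - 2 * (?a v w * ?d w))
      = (\<Sum>w\<in>A. (?d w)\<^sup>2 + 2 * (?a u w * ?d w) - 2 * (?a v w * ?d w))
        - ((?d v)\<^sup>2 + 2 * (?a u v * ?d v))"
    using finite_A vA E(2) by (simp add: sum.remove[of A v])
  also have "(\<Sum>w\<in>A. (?d w)\<^sup>2 + 2 * (?a u w * ?d w) - 2 * (?a v w * ?d w))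
      = (\<Sum>w\<in>A. (?d w)\<^sup>2) + 2 * (\<Sum>w\<in>A. ?a u w * ?d w) - 2 * (\<Sum>w\<in>A. ?a v w * ?d w)"
    by (simp only: sum.distrib sum_subtractf sum_distrib_left)
  finally have "cherry_weight E u - cherry_weight E v \<le> (?d u)\<^sup>2 - (?d u - ?a u v)\<^sup>2 + 2 * (?a u v * ?d v)"
    by (simp add: cherry_weight_def)
  also have "\<dots> \<le> 2 * ?d u + 2 * ?d v"
    using deg_in_nonneg[of E A u] deg_in_nonneg[of E A v]
    by (auto simp: power2_eq_square algebra_simps of_bool_def)
  also have "\<dots> \<le> 4 * real (s * n)" using deg_le[of E u] deg_le[of E v] by simp
  finally show ?thesis by simp
qed simp

section \<open>Missing pairs at a largest clique with at most two vertices per part\<close>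

text \<open>Relaxing "exactly two" to "at most two" admits the empty set, so a largest such clique
  exists; in a balanced-free graph it falls short in some part.\<close>

definition light_clique :: "('a \<times> 'a) set \<Rightarrow> 'a set \<Rightarrow> bool" where
  "light_clique E T \<longleftrightarrow> T \<subseteq> A \<and> clique_on E T \<and> (\<forall>i\<in>{1..s}. card (T \<inter> V i) \<le> 2)"

text \<open>Were \<open>w\<close> adjacent to all of \<open>T\<close>, it would lie outside
  \<open>T\<close> by irreflexivity, and \<open>insert w T\<close> would be a larger light clique,
  as \<open>V j\<close> has room for it.\<close>

lemma non_neighbour_of_maximum_light_clique:
  assumes free: "balanced_free E" and T: "light_clique E T"
    and max: "\<And>T'. light_clique E T' \<Longrightarrow> card T' \<le> card T"
    and j: "j \<in> {1..s}" "card (T \<inter> V j) \<le> 1" and w: "w \<in> V j"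
  shows "T - E `` {w} \<noteq> {}"
proof
  assume adj: "T - E `` {w} = {}"
  have "w \<notin> E `` {w}" using free by (auto simp: balanced_free_def irrefl_def)
  then have "w \<notin> T" using adj by auto
  have "sym E" using free by (simp add: balanced_free_def)
  have "finite T" using T finite_A finite_subset by (auto simp: light_clique_def)
  have "light_clique E (insert w T)"
    unfolding light_clique_def
  proof (intro conjI ballI)
    show "insert w T \<subseteq> A" using T w j part_subset by (auto simp: light_clique_def)
    show "clique_on E (insert w T)"
      using T adj symD[OF \<open>sym E\<close>] by (auto simp: light_clique_def clique_on_def)
    fix i assume i: "i \<in> {1..s}"
    show "card (insert w T \<inter> V i) \<le> 2"
    proof (cases "i = j")
      case True
      then have "card (insert w T \<inter> V i) \<le> Suc (card (T \<inter> V j))"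
        using card_insert_le_m1 \<open>finite T\<close> by (simp add: Int_insert_left card_insert_if)
      then show ?thesis using j by simp
    next
      case False
      then have "insert w T \<inter> V i = T \<inter> V i" using parts_disjoint[OF i j(1)] w by auto
      then show ?thesis using T i by (simp add: light_clique_def)
    qed
  qed
  then show False using max[of "insert w T"] \<open>w \<notin> T\<close> \<open>finite T\<close> by simp
qed

text \<open>For a largest light clique \<open>T\<close> with room in \<open>V j\<close>, every
  vertex of \<open>V j\<close> misses a vertex of \<open>T\<close>. This gives \<open>n\<close>
  missing pairs; the other \<open>n\<close> have a different source in each case below. The extra
  vertex \<open>u\<close> may lie in \<open>T\<close>: counted with multiplicity, \<open>T\<close>
  and \<open>u\<close> still have at most two members per part, which is what averaging over the
  parts requires.\<close>

lemma ex_balanced_family_of_large_codeg: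
  assumes free: "balanced_free E" and "n > 0"
  obtains T j u where "T \<subseteq> A" "\<And>i. i \<in> {1..s} \<Longrightarrow> card (T \<inter> V i) \<le> 2"
    "j \<in> {1..s}" "card (T \<inter> V j) \<le> 1" "u \<in> V j" "2 * real n \<le> (\<Sum>v\<in>T. codeg E v) + codeg E u"
proof -
  have E: "sym E" "irrefl E" using free by (auto simp: balanced_free_def)
  have "finite {T. light_clique E T}"
    by (rule finite_subset[of _ "Pow A"]) (auto simp: light_clique_def finite_A)
  moreover have "light_clique E {}" by (auto simp: light_clique_def clique_on_def)
  ultimately obtain T where T: "light_clique E T"
    and max: "\<And>T'. light_clique E T' \<Longrightarrow> card T' \<le> card T"
    using ex_maximal_value[of "{T. light_clique E T}" "\<lambda>T. real (card T)"] by auto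
  have TA: "T \<subseteq> A" and T2: "\<And>i. i \<in> {1..s} \<Longrightarrow> card (T \<inter> V i) \<le> 2" and Tc: "clique_on E T"
    using T by (auto simp: light_clique_def)
  have fT: "finite T" using TA finite_A finite_subset by blast
  obtain j where j: "j \<in> {1..s}" "card (T \<inter> V j) \<noteq> 2"
    using free TA Tc by (auto simp: balanced_free_def)
  then have j1: "card (T \<inter> V j) \<le> 1" using T2[of j] by auto
  have fj: "finite (V j)" using finite_part j by simp
  let ?c = "\<lambda>w. card (T - E `` {w})"
  have c1: "?c w \<ge> 1" if "w \<in> V j" for w
    using non_neighbour_of_maximum_light_clique[OF free T max j(1) j1 that] fT
    by (simp add: Suc_le_eq card_gt_0_iff)
  have codeg_ge: "real (card (S - E `` {v})) \<le> codeg E v" if "S \<subseteq> A" for S v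
    unfolding codeg_eq_card using that finite_A by (intro of_nat_mono card_mono) auto
  have sum_c: "real (\<Sum>w\<in>V j. ?c w) \<le> (\<Sum>v\<in>T. codeg E v)"
    using sum_card_non_adjacent_swap[OF E(1) fj fT] codeg_ge[OF part_subset[OF j(1)]]
    by (auto intro: sum_mono)
  have n_card: "card (V j) = n" using card_part j by simp
  \<comment> \<open>Vertices with a single non-neighbour in \<open>T\<close> are all that stands
    between the count and \<open>2 * n\<close>; each gets one unit of credit, to be paid for in the
    cases below.\<close>
  define B where "B = {w \<in> V j. ?c w = 1}"
  have B: "B \<subseteq> V j" "finite B" using fj by (auto simp: B_def)
  have "2 * n \<le> (\<Sum>w\<in>V j. ?c w + of_bool (w \<in> B))"
  proof -
    have "2 \<le> ?c w + of_bool (w \<in> B)" if "w \<in> V j" for w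
      using c1[OF that] that by (auto simp: B_def)
    then show ?thesis
      using sum_bounded_below[of "V j" 2 "\<lambda>w. ?c w + of_bool (w \<in> B)"] n_card by (simp add: mult.commute)
  qed
  also have "\<dots> = (\<Sum>w\<in>V j. ?c w) + card B"
    using fj B by (simp add: sum.distrib Int_absorb1)
  finally have two_n: "2 * n \<le> (\<Sum>w\<in>V j. ?c w) + card B" .
  have unique: "\<exists>y. T - E `` {w} = {y}" if "w \<in> B" for w
    using that by (auto simp: B_def card_1_singleton_iff)
  consider "B = {}" | u y where "u \<in> B" "T - E `` {u} = {y}" "y \<notin> V j"
    | "B \<noteq> {}" "\<And>u y. u \<in> B \<Longrightarrow> T - E `` {u} = {y} \<Longrightarrow> y \<in> V j"
    by blast
  then show thesis
  proof cases
    \<comment> \<open>Every vertex of \<open>V j\<close> misses two vertices of \<open>T\<close>.\<close>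
    case 1
    obtain u where "u \<in> V j" using n_card \<open>n > 0\<close> by fastforce
    moreover have "real (2 * n) \<le> real (\<Sum>w\<in>V j. ?c w)"
      using two_n 1 unfolding of_nat_le_iff by simp
    then have "2 * real n \<le> real (\<Sum>w\<in>V j. ?c w)" by (simp del: of_nat_sum)
    moreover have "codeg E u \<ge> 0" by (simp add: codeg_eq_card)
    ultimately show thesis using that[OF TA T2 j(1) j1] sum_c by force
  next
    \<comment> \<open>Exchanging \<open>y\<close> for \<open>u\<close> moves the deficiency of \<open>T\<close> to the part of \<open>y\<close>; the pairs missing
      towards the two parts are distinct.\<close>
    case (2 u y)
    have uj: "u \<in> V j" using 2 B by auto
    have y: "y \<in> T" "(u, y) \<notin> E" using 2 by auto
    have adj: "(u, x) \<in> E" if "x \<in> T" "x \<noteq> y" for x using that 2 by auto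
    have "u \<notin> T"
    proof
      assume "u \<in> T"
      then have "u = y" using adj[of u] E(2) by (auto simp: irrefl_def)
      then show False using uj 2 by simp
    qed
    obtain k where k: "k \<in> {1..s}" "y \<in> V k" using TA y union_parts by auto
    have "k \<noteq> j" using k 2 by auto
    have ynj: "y \<notin> V i" if "i \<in> {1..s}" "i \<noteq> k" for i using parts_disjoint[OF that(1) k(1) that(2)] k by auto
    have unj: "u \<notin> V i" if "i \<in> {1..s}" "i \<noteq> j" for i using parts_disjoint[OF that(1) j(1) that(2)] uj by auto
    let ?T = "insert u (T - {y})"
    have card_k: "card (?T \<inter> V k) \<le> 1"
    proof -
      have "?T \<inter> V k = T \<inter> V k - {y}" using unj[OF k(1) \<open>k \<noteq> j\<close>] by auto
      then show ?thesis using T2[OF k(1)] y k fT by (simp add: card_Diff_singleton)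
    qed
    have "light_clique E ?T"
      unfolding light_clique_def
    proof (intro conjI ballI)
      show "?T \<subseteq> A" using TA uj part_subset[OF j(1)] by auto
      show "clique_on E ?T"
        using Tc adj symD[OF E(1)] by (auto simp: clique_on_def)
      fix i assume i: "i \<in> {1..s}"
      consider "i = j" | "i = k" | "i \<noteq> j" "i \<noteq> k" by blast
      then show "card (?T \<inter> V i) \<le> 2"
      proof cases
        case 1
        then have "?T \<inter> V i = insert u (T \<inter> V j)" using uj 2 by auto
        then show ?thesis using j1 fT by (simp add: card_insert_if)
      next
        case 2
        then show ?thesis using card_k by simp
      next
        case 3
        then have "?T \<inter> V i = T \<inter> V i" using unj[OF i] ynj[OF i] by auto
        then show ?thesis using T2 i by simp
      qed
    qed
    \<comment> \<open>Equal size makes \<open>?T\<close> another largest light clique, so each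
      vertex of \<open>V k\<close>, where \<open>?T\<close> has room, misses a vertex of
      \<open>?T\<close>.\<close>
    moreover have "card ?T = card T"
      using fT \<open>u \<notin> T\<close> card_Suc_Diff1[OF fT y(1)] by (simp del: card_Diff_singleton)
    ultimately have "?T - E `` {w} \<noteq> {}" if "w \<in> V k" for w
      using non_neighbour_of_maximum_light_clique[OF free _ _ k(1) card_k that] max by simp
    then have ck: "1 \<le> card (?T - E `` {w})" if "w \<in> V k" for w
      using fT that by (simp add: Suc_le_eq card_gt_0_iff)
    have "n \<le> (\<Sum>w\<in>V k. card (?T - E `` {w}))"
      using sum_bounded_below[of "V k" 1 "\<lambda>w. card (?T - E `` {w})"] ck card_part[OF k(1)] by simp
    also have "\<dots> = (\<Sum>v\<in>?T. card (V k - E `` {v}))"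
      using fT finite_part[OF k(1)] E(1) by (intro sum_card_non_adjacent_swap) auto
    also have "\<dots> = card (V k - E `` {u}) + (\<Sum>v\<in>T - {y}. card (V k - E `` {v}))"
      using fT \<open>u \<notin> T\<close> by (subst sum.insert) auto
    finally have n1: "n \<le> card (V k - E `` {u}) + (\<Sum>v\<in>T - {y}. card (V k - E `` {v}))" .
    have "n \<le> (\<Sum>w\<in>V j. ?c w)"
      using sum_bounded_below[of "V j" 1 ?c] c1 n_card by simp
    also have "\<dots> = (\<Sum>v\<in>T. card (V j - E `` {v}))"
      by (rule sum_card_non_adjacent_swap[OF E(1) fj fT])
    also have "\<dots> = card (V j - E `` {y}) + (\<Sum>v\<in>T - {y}. card (V j - E `` {v}))"
      using fT y by (intro sum.remove)
    finally have n2: "n \<le> card (V j - E `` {y}) + (\<Sum>v\<in>T - {y}. card (V j - E `` {v}))" .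
    \<comment> \<open>A vertex of \<open>T - {y}\<close> is charged for both parts, whose
      disjointness lets one codegree pay; \<open>u\<close> is charged for \<open>V k\<close> only
      and \<open>y\<close> for \<open>V j\<close> only.\<close>
    have both: "real (card (V j - E `` {v}) + card (V k - E `` {v})) \<le> codeg E v" for v
    proof -
      have "card (V j - E `` {v}) + card (V k - E `` {v}) = card ((V j \<union> V k) - E `` {v})"
        using fj finite_part[OF k(1)] parts_disjoint[OF k(1) j(1) \<open>k \<noteq> j\<close>]
        by (subst card_Un_disjoint[symmetric]) (auto intro: arg_cong[where f = card])
      then show ?thesis using codeg_ge[of "V j \<union> V k" v] part_subset j(1) k(1) by simp
    qed
    have "(\<Sum>v\<in>T - {y}. real (card (V j - E `` {v}) + card (V k - E `` {v}))) \<le> (\<Sum>v\<in>T - {y}. codeg E v)"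
      by (intro sum_mono both)
    moreover have "2 * real n \<le> real (card (V k - E `` {u})) + real (card (V j - E `` {y}))
        + (\<Sum>v\<in>T - {y}. real (card (V j - E `` {v}) + card (V k - E `` {v})))"
      using n1 n2 by (simp add: sum.distrib flip: of_nat_sum of_nat_add)
    moreover have "real (card (V k - E `` {u})) \<le> codeg E u" "real (card (V j - E `` {y})) \<le> codeg E y"
      using codeg_ge part_subset j(1) k(1) by auto
    moreover have "(\<Sum>v\<in>T. codeg E v) = codeg E y + (\<Sum>v\<in>T - {y}. codeg E v)"
      using fT y by (intro sum.remove)
    ultimately show thesis using that[OF TA T2 j(1) j1 uj] by simp
  next
    \<comment> \<open>All of \<open>B\<close> misses the only vertex \<open>x\<close> of \<open>T\<close> in \<open>V j\<close>, so counting \<open>x\<close> twice pays for \<open>B\<close>.\<close>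
    case 3
    obtain u x where u: "u \<in> B" "T - E `` {u} = {x}" using 3(1) unique by blast
    have x: "x \<in> T \<inter> V j" using u 3(2)[OF u] by auto
    have "w \<notin> E `` {x}" if w: "w \<in> B" for w
    proof -
      obtain z where z: "T - E `` {w} = {z}" using unique w by blast
      then have "z \<in> T \<inter> V j" using 3(2)[OF w] by auto
      then have "z = x" using x j1 fT card_le_Suc0_iff_eq[of "T \<inter> V j"] by auto
      then show ?thesis using z symD[OF E(1)] by auto
    qed
    then have "B \<subseteq> A - E `` {x}" using B part_subset[OF j(1)] by auto
    then have "real (card B) \<le> codeg E x"
      unfolding codeg_eq_card using finite_A by (intro of_nat_mono card_mono) auto
    moreover have "2 * real n \<le> real (\<Sum>w\<in>V j. ?c w) + real (card B)" using two_n
      by (simp flip: of_nat_sum of_nat_add)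
    ultimately show thesis using that[OF TA T2 j(1) j1, of x] x sum_c by force
  qed
qed

text \<open>Edge-maximality puts each codegree within 1 of the average over its part. Hence a family
  with at most two members per part and total codegree at least \<open>2 * n\<close> forces a large
  sum over all of \<open>A\<close>.\<close>

lemma sum_codeg_ge_of_max_sum:
  assumes free: "balanced_free E"
    and max: "\<And>H. balanced_free H \<Longrightarrow> (\<Sum>w\<in>A. deg H w) \<le> (\<Sum>w\<in>A. deg E w)"
  shows "(real n)\<^sup>2 - real s * real n \<le> (\<Sum>v\<in>A. codeg E v)"
proof (cases "n = 0")
  case True
  then have "A = {}" using card_A finite_A by simp
  then show ?thesis using True by simp
next
  case False
  then obtain T j u where T: "T \<subseteq> A" "\<And>i. i \<in> {1..s} \<Longrightarrow> card (T \<inter> V i) \<le> 2"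
    "j \<in> {1..s}" "card (T \<inter> V j) \<le> 1" "u \<in> V j"
    "2 * real n \<le> (\<Sum>v\<in>T. codeg E v) + codeg E u"
    using ex_balanced_family_of_large_codeg[OF free] by blast
  \<comment> \<open>The summand \<open>real n\<close> allows 1 for each vertex of the part, so that
    \<open>M i\<close> dominates \<open>n\<close> times any codegree in it.\<close>
  define M where "M i = (\<Sum>w\<in>V i. codeg E w) + real n" for i
  have M0: "M i \<ge> 0" for i by (simp add: M_def codeg_eq_card sum_nonneg)
  have le_M: "real n * codeg E v \<le> M i" if "i \<in> {1..s}" "v \<in> V i" for i v
  proof -
    have "(\<Sum>w\<in>V i. codeg E v) \<le> (\<Sum>w\<in>V i. codeg E w + 1)"
      using deg_le_of_max_sum[OF free max that(1) _ that(2)] by (intro sum_mono) (force simp: codeg_def)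
    then show ?thesis using that by (simp add: M_def card_part sum.distrib)
  qed
  have "2 * (real n)\<^sup>2 \<le> real n * ((\<Sum>v\<in>T. codeg E v) + codeg E u)"
    using mult_left_mono[OF T(6), of "real n"] by (simp add: power2_eq_square)
  also have "\<dots> = (\<Sum>i\<in>{1..s}. \<Sum>v\<in>T \<inter> V i. real n * codeg E v) + real n * codeg E u"
    by (simp only: sum_parts[OF T(1)] sum_distrib_left distrib_left)
  also have "\<dots> \<le> (\<Sum>i\<in>{1..s}. real (card (T \<inter> V i)) * M i) + M j"
    using le_M T(3,5) by (intro add_mono sum_mono sum_bounded_above) auto
  \<comment> \<open>The extra vertex \<open>u\<close> is booked on part \<open>j\<close>, where
    \<open>T\<close> has at most one vertex, so every multiplicity stays at most 2.\<close>
  also have "\<dots> = (\<Sum>i\<in>{1..s}. (real (card (T \<inter> V i)) + of_bool (i = j)) * M i)"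
    using T(3) by (simp add: distrib_right sum.distrib of_bool_def if_distrib[where f = "\<lambda>x. x * _"] sum.delta cong: if_cong)
  also have "\<dots> \<le> (\<Sum>i\<in>{1..s}. 2 * M i)"
  proof (intro sum_mono mult_right_mono M0)
    fix i assume "i \<in> {1..s}"
    then show "real (card (T \<inter> V i)) + of_bool (i = j) \<le> 2" using T(2)[of i] T(4) by auto
  qed
  also have "\<dots> = 2 * (\<Sum>v\<in>A. codeg E v) + 2 * (real s * real n)"
    using sum_parts[of A "codeg E"] part_subset
    by (simp add: M_def sum.distrib sum_distrib_left[symmetric] Int_absorb1 distrib_left)
  finally show ?thesis by simp
qed

section \<open>Bounding the sum of squared degrees\<close>

text \<open>In the total weight of the part, each \<open>w\<close> contributes
  \<open>2 * deg E w\<close> for every neighbour it has there. Of the doubled sum of squares, one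
  copy over the part is contained in the total weight; the other copy, and both copies over the
  rest, are estimated through these contributions.\<close>

lemma sum_squares_deg_le_of_light_part:
  assumes free: "balanced_free E" and i: "i \<in> {1..s}"
    and light: "\<And>u. u \<in> V i \<Longrightarrow> cherry_weight E u \<le> W"
  shows "2 * (\<Sum>v\<in>A. (deg E v)\<^sup>2) \<le> real n * W + 3 * (real s - 1)\<^sup>2 * real n ^ 3 + 2 * (real s - 1) ^ 3 * real n ^ 3"
proof -
  have E: "sym E" using free by (simp add: balanced_free_def)
  let ?r = "(real s - 1) * real n"
  define P R where "P = V i" and "R = A - P"
  have PA: "P \<subseteq> A" using part_subset i by (simp add: P_def)
  have fin: "finite P" "finite R" using finite_A PA finite_subset by (auto simp: R_def)
  have cP: "card P = n" using card_part i by (simp add: P_def)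
  have cR: "real (card R) = ?r"
    using card_Diff_subset[OF fin(1) PA] card_mono[OF finite_A PA]
    by (simp add: R_def card_A cP of_nat_diff left_diff_distrib)
  have r0: "0 \<le> ?r" using cR by (metis of_nat_0_le_iff)
  let ?d = "deg E" and ?p = "deg_in E P" and ?q = "deg_in E R"
  have split: "sum f A = sum f P + sum f R" for f :: "'a \<Rightarrow> real"
    using sum.subset_diff[OF PA finite_A, of f] by (simp add: R_def)
  have d: "?d v = ?p v + ?q v" for v unfolding deg_in_def by (rule split)
  have q_le: "?q v \<le> ?r" for v using deg_in_le_card[of E R v] cR by simp
  have nonneg: "0 \<le> ?p v" "0 \<le> ?q v" for v by (rule deg_in_nonneg)+
  have cross: "(\<Sum>v\<in>R. ?p v) = (\<Sum>v\<in>P. ?q v)" by (rule sum_deg_in_swap[OF E])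
  have cross_le: "(\<Sum>v\<in>P. ?q v) \<le> real n * ?r"
    using sum_bounded_above[of P ?q ?r] q_le by (simp add: cP)
  have "(\<Sum>v\<in>P. (?d v)\<^sup>2) + 2 * (\<Sum>w\<in>A. ?d w * ?p w) = (\<Sum>v\<in>P. cherry_weight E v)"
    using sum_weighted_deg_in_swap[OF E, where S = P and T = A and f = ?d]
    by (simp add: cherry_weight_def sum.distrib sum_distrib_left[symmetric] del: sum_of_bool_mult_eq)
  also have "\<dots> \<le> real n * W"
    using sum_bounded_above[of P "cherry_weight E" W] light[folded P_def] by (simp add: cP)
  finally have weight: "(\<Sum>v\<in>P. (?d v)\<^sup>2) + 2 * (\<Sum>w\<in>P. ?d w * ?p w) + 2 * (\<Sum>w\<in>R. ?d w * ?p w) \<le> real n * W"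
    by (simp add: split distrib_left)
  \<comment> \<open>Only one factor \<open>?d w\<close> is split, which keeps the product
    \<open>?d w * ?p w\<close> that \<open>weight\<close> controls.\<close>
  have "(?d w)\<^sup>2 \<le> ?d w * ?p w + ?r * ?p w + ?r * ?r" for w
  proof -
    have "?d w * ?q w \<le> (?p w + ?r) * ?r"
      unfolding d[of w] using q_le[of w] nonneg[of w] r0 by (intro mult_mono) auto
    then show ?thesis by (simp add: d[of w] power2_eq_square algebra_simps)
  qed
  then have "(\<Sum>w\<in>R. (?d w)\<^sup>2) \<le> (\<Sum>w\<in>R. ?d w * ?p w + ?r * ?p w + ?r * ?r)"
    by (intro sum_mono)
  then have outside: "(\<Sum>w\<in>R. (?d w)\<^sup>2) \<le> (\<Sum>w\<in>R. ?d w * ?p w) + ?r * (\<Sum>w\<in>P. ?q w) + ?r * (?r * ?r)"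
    by (simp only: sum.distrib sum_distrib_left[symmetric] cross sum_constant cR mult_ac)
  have "(?d v)\<^sup>2 \<le> 2 * (?d v * ?p v) + ?r * ?q v" for v
  proof -
    have "(?d v)\<^sup>2 = 2 * (?d v * ?p v) + (?q v * ?q v - ?p v * ?p v)"
      by (simp add: d[of v] power2_eq_square algebra_simps)
    moreover have "?q v * ?q v \<le> ?r * ?q v" using q_le[of v] nonneg[of v] by (intro mult_right_mono)
    moreover have "0 \<le> ?p v * ?p v" by simp
    ultimately show ?thesis by linarith
  qed
  then have "(\<Sum>v\<in>P. (?d v)\<^sup>2) \<le> (\<Sum>v\<in>P. 2 * (?d v * ?p v) + ?r * ?q v)"
    by (intro sum_mono)
  then have inside: "(\<Sum>v\<in>P. (?d v)\<^sup>2) \<le> 2 * (\<Sum>v\<in>P. ?d v * ?p v) + ?r * (\<Sum>v\<in>P. ?q v)"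
    by (simp only: sum.distrib sum_distrib_left[symmetric])
  \<comment> \<open>\<open>outside\<close> enters twice and \<open>inside\<close> once, so the edges
    leaving \<open>P\<close> are counted three times.\<close>
  have "2 * (\<Sum>v\<in>A. (?d v)\<^sup>2) \<le> real n * W + 3 * (?r * (\<Sum>v\<in>P. ?q v)) + 2 * (?r * (?r * ?r))"
    using weight outside inside split[of "\<lambda>v. (?d v)\<^sup>2"] by linarith
  also have "\<dots> \<le> real n * W + 3 * (?r * (real n * ?r)) + 2 * (?r * (?r * ?r))"
    using mult_left_mono[OF cross_le r0] by simp
  finally show ?thesis by (simp add: power2_eq_square power3_eq_cube algebra_simps)
qed

lemma sum_squares_deg_le:
  assumes free: "balanced_free E" and s: "s \<ge> 2"
  shows "(\<Sum>v\<in>A. (deg E v)\<^sup>2)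
    \<le> ((real s)\<^sup>2 * (real s - 1) + (real s - 1)\<^sup>2) * real n ^ 3 + 4 * real s ^ 3 * (real n)\<^sup>2"
proof -
  obtain H where H: "balanced_free H"
    and max: "\<And>H'. balanced_free H' \<Longrightarrow> (\<Sum>v\<in>A. (deg H' v)\<^sup>2) \<le> (\<Sum>v\<in>A. (deg H v)\<^sup>2)"
    using ex_maximal_balanced_free[OF free, of "\<lambda>E. \<Sum>v\<in>A. (deg E v)\<^sup>2"] by blast
  have s_le_cube: "real s * real s \<le> real s ^ 3"
    using s by (simp add: power3_eq_cube mult_le_cancel_left1)
  have "(\<Sum>v\<in>A. (deg H v)\<^sup>2)
    \<le> ((real s)\<^sup>2 * (real s - 1) + (real s - 1)\<^sup>2) * real n ^ 3 + 4 * real s ^ 3 * (real n)\<^sup>2"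
  proof (cases "\<exists>v\<in>A. deg H v \<le> (real s - 1) * real n")
    case True
    then obtain i v where i: "i \<in> {1..s}" and v: "v \<in> V i" "deg H v \<le> (real s - 1) * real n"
      using union_parts by auto
    have "(\<Sum>w\<in>A. of_bool ((v, w) \<in> H) * deg H w) \<le> (\<Sum>w\<in>A. of_bool ((v, w) \<in> H) * (real s * real n))"
      using deg_le[of H] by (intro sum_mono mult_left_mono) auto
    also have "\<dots> = deg H v * (real s * real n)"
      by (simp only: deg_in_def sum_distrib_right)
    also have "\<dots> \<le> ((real s - 1) * real n) * (real s * real n)"
      using v by (intro mult_right_mono) auto
    finally have "2 * (\<Sum>w\<in>A. of_bool ((v, w) \<in> H) * deg H w) \<le> 2 * (((real s - 1) * real n) * (real s * real n))"
      by simp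
    moreover have "(deg H v)\<^sup>2 \<le> ((real s - 1) * real n)\<^sup>2"
      using v deg_in_nonneg by (intro power_mono) auto
    ultimately have "cherry_weight H v \<le> ((real s - 1) * real n)\<^sup>2 + 2 * (((real s - 1) * real n) * (real s * real n))"
      unfolding cherry_weight_def by (rule add_mono[rotated])
    then have "cherry_weight H u \<le> ((real s - 1) * real n)\<^sup>2 + 2 * (((real s - 1) * real n) * (real s * real n))
        + 4 * (real s * real n)" if "u \<in> V i" for u
      using cherry_weight_le_of_max_sum_squares[OF H max i that v(1)] by simp
    \<comment> \<open>The leading term comes out exactly: \<open>(s - 1)\<^sup>2 / 2 + s * (s - 1) +
      3 * (s - 1)\<^sup>2 / 2 + (s - 1) ^ 3\<close> equals
      \<open>s\<^sup>2 * (s - 1) + (s - 1)\<^sup>2\<close>. The slack between weights costs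
      \<open>2 * s * n\<^sup>2\<close>.\<close>
    from sum_squares_deg_le_of_light_part[OF H i this]
    have "(\<Sum>v\<in>A. (deg H v)\<^sup>2)
        \<le> ((real s)\<^sup>2 * (real s - 1) + (real s - 1)\<^sup>2) * real n ^ 3 + 2 * real s * (real n)\<^sup>2"
      by (simp add: power2_eq_square power3_eq_cube algebra_simps)
    moreover have "2 * real s * (real n)\<^sup>2 \<le> 4 * real s ^ 3 * (real n)\<^sup>2"
    proof (rule mult_right_mono)
      have "real s \<le> real s * real s" using s by (simp add: mult_le_cancel_left1)
      then show "2 * real s \<le> 4 * real s ^ 3" using s_le_cube by linarith
    qed simp
    ultimately show ?thesis by linarith
  next
    case False
    \<comment> \<open>\<open>H\<close> need not have the most edges, but it has no more than
      \<open>D\<close>, so a lower bound on the total codegree of \<open>D\<close> passes to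
      \<open>H\<close>.\<close>
    obtain D where D: "balanced_free D"
      and D_max: "\<And>H'. balanced_free H' \<Longrightarrow> (\<Sum>v\<in>A. deg H' v) \<le> (\<Sum>v\<in>A. deg D v)"
      using ex_maximal_balanced_free[OF free, of "\<lambda>E. \<Sum>v\<in>A. deg E v"] by blast
    \<comment> \<open>For a codegree \<open>x\<close> between 0 and \<open>n\<close>, expanding
      \<open>(s * n - x)\<^sup>2\<close> leaves
      \<open>x\<^sup>2 - 2 * s * n * x \<le> - c * x\<close>.\<close>
    define c where "c = (2 * real s - 1) * real n"
    have c0: "0 \<le> c" using s by (simp add: c_def)
    have "(real n)\<^sup>2 - real s * real n \<le> (\<Sum>v\<in>A. codeg D v)"
      by (rule sum_codeg_ge_of_max_sum[OF D D_max])
    also have "\<dots> \<le> (\<Sum>v\<in>A. codeg H v)"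
      using D_max[OF H] by (simp add: codeg_def sum_subtractf)
    finally have codeg_sum: "(real n)\<^sup>2 - real s * real n \<le> (\<Sum>v\<in>A. codeg H v)" .
    have "(deg H v)\<^sup>2 \<le> (real s * real n)\<^sup>2 - c * codeg H v" if "v \<in> A" for v
    proof -
      have "codeg H v \<le> real n" using False that by (force simp: codeg_def algebra_simps)
      moreover have "0 \<le> codeg H v" by (simp add: codeg_eq_card)
      ultimately have "codeg H v * codeg H v \<le> real n * codeg H v" by (intro mult_right_mono)
      moreover have "(deg H v)\<^sup>2 = (real s * real n)\<^sup>2 - c * codeg H v - real n * codeg H v + codeg H v * codeg H v"
        by (simp add: c_def codeg_def power2_eq_square algebra_simps)
      ultimately show ?thesis by simp
    qed
    then have "(\<Sum>v\<in>A. (deg H v)\<^sup>2) \<le> (\<Sum>v\<in>A. (real s * real n)\<^sup>2 - c * codeg H v)"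
      by (rule sum_mono)
    also have "\<dots> = real s * real n * (real s * real n)\<^sup>2 - c * (\<Sum>v\<in>A. codeg H v)"
      by (simp add: sum_subtractf sum_distrib_left card_A)
    also have "\<dots> \<le> real s * real n * (real s * real n)\<^sup>2 - c * ((real n)\<^sup>2 - real s * real n)"
      using mult_left_mono[OF codeg_sum c0] by simp
    \<comment> \<open>The leading coefficient is \<open>s ^ 3 - (2 * s - 1)\<close>,
      rewritten.\<close>
    also have "\<dots> = ((real s)\<^sup>2 * (real s - 1) + (real s - 1)\<^sup>2) * real n ^ 3
        + (2 * (real s * real s) - real s) * (real n)\<^sup>2"
      by (simp add: c_def power2_eq_square power3_eq_cube algebra_simps)
    also have "(2 * (real s * real s) - real s) * (real n)\<^sup>2 \<le> 4 * real s ^ 3 * (real n)\<^sup>2"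
    proof (rule mult_right_mono)
      show "2 * (real s * real s) - real s \<le> 4 * real s ^ 3"
        using s_le_cube by (smt (verit) of_nat_0_le_iff zero_le_power)
    qed simp
    finally show ?thesis by simp
  qed
  then show ?thesis using max[OF free] by linarith
qed

end

section \<open>Passage from relations back to graphs with arcs\<close>

text \<open>Turns a balanced clique given as a vertex set into a forbidden subgraph. Its order
  \<open>2 * s\<close> follows because the parts are disjoint and cover all vertices.\<close>

lemma balanced_complete_in_induce_subgraph:
  assumes "graph G" "(\<Union>i\<in>{1..s}. V i) = verts G" "disjoint_family_on V {1..s}"
    and K: "K \<subseteq> verts G" "clique_on (arcs_ends G) K" "\<forall>i\<in>{1..s}. card (K \<inter> V i) = 2"
  shows "balanced_complete_in s V G (G \<restriction> K)"
proof -
  interpret graph G by fact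
  have sub: "subgraph (G \<restriction> K) G" using K(1) by (intro induced_imp_subgraph induced_induce)
  interpret H: digraph "G \<restriction> K" by (rule digraph_subgraph[OF sub])
  have "graph (G \<restriction> K)"
    using induced_graph_imp_symmetric[OF sym_arcs induced_induce] K(1) by (intro H.graphI)
  have "finite K" using K(1) finite_verts finite_subset by blast
  have "card K = card (\<Union>i\<in>{1..s}. K \<inter> V i)"
    using K(1) assms(2) by (intro arg_cong[where f = card]) auto
  also have "\<dots> = (\<Sum>i\<in>{1..s}. card (K \<inter> V i))"
    using assms(3) \<open>finite K\<close> by (intro card_UN_disjoint) (auto simp: disjoint_family_on_def)
  also have "\<dots> = 2 * s" using K(3) by simp
  finally have card_K: "card K = 2 * s" .
  have "arcs_ends (G \<restriction> K) = {(u, v). (u, v) \<in> K \<times> K \<and> u \<noteq> v}"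
    using K(2) no_loops unfolding clique_on_def arcs_ends_conv
    by (force simp: induce_subgraph_arcs)
  then show ?thesis
    using sub card_K K(3) \<open>graph (G \<restriction> K)\<close> by (simp add: balanced_complete_in_def complete_digraph_def)
qed

text \<open>Without parallel arcs, \<open>head G\<close> is injective on the arcs leaving
  \<open>v\<close>, so counting arcs is counting neighbours.\<close>

lemma (in graph) out_degree_eq_deg_in: "real (out_degree G v) = deg_in (arcs_ends G) (verts G) v"
proof -
  have "bij_betw (head G) (out_arcs G v) (verts G \<inter> arcs_ends G `` {v})"
    unfolding bij_betw_def
  proof
    show "inj_on (head G) (out_arcs G v)"
      by (intro inj_onI no_multi_arcs) (auto simp: arc_to_ends_def)
    show "head G ` out_arcs G v = verts G \<inter> arcs_ends G `` {v}"
      by (force simp: arcs_ends_conv)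
  qed
  then show ?thesis by (simp add: out_degree_def deg_in_eq_card bij_betw_same_card)
qed

theorem theorem2p3:
  fixes s n :: nat
    and G :: "('a, 'b) pre_digraph"
    and V :: "nat \<Rightarrow> 'a set"
  assumes "s \<ge> 2"
    and "graph G"
    and "balanced_partition s n V (verts G)"
    and "balanced_complete_free s V G"
  shows "real (degree_square_sum G) \<le>
    ((real s)\<^sup>2 * (real s - 1) + (real s - 1)\<^sup>2) * real n ^ 3 + 4 * real s ^ 3 * (real n)\<^sup>2"
proof -
  interpret graph G by fact
  interpret equipartition s n V "verts G"
    using assms(3) by unfold_locales (auto simp: balanced_partition_def)
  have "balanced_free (arcs_ends G)"
    unfolding balanced_free_def
  proof (intro conjI)
    show "arcs_ends G \<subseteq> verts G \<times> verts G" by (auto simp: arcs_ends_conv)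
    show "sym (arcs_ends G)" using sym_arcs by (simp add: symmetric_def)
    show "irrefl (arcs_ends G)" using no_loops by (fastforce simp: irrefl_def arcs_ends_conv)
    show "\<not> (\<exists>K\<subseteq>verts G. clique_on (arcs_ends G) K \<and> (\<forall>i\<in>{1..s}. card (K \<inter> V i) = 2))"
      using assms(4) balanced_complete_in_induce_subgraph[OF assms(2) union_parts disjoint_parts]
      unfolding balanced_complete_free_def by blast
  qed
  from sum_squares_deg_le[OF this assms(1)] show ?thesis
    by (simp add: degree_square_sum_def out_degree_eq_deg_in)
qed

end
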